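(* Let $n, d \geq 2$ be integers. For any integer $s$ with $1 \leq s \leq \min(n, d/55)$ and any estimator $\widehat P_n = \Phi(X_1,\dots,X_n)$, where $\Phi:\{1,\dots,d\}^n\to\mathcal{P}_d$, there exists a distribution $P \in \mathcal{P}_{s,d}$ such that $$\mathbb{P}_P\bigg( \mathrm{KL}(P,\widehat P_n) \geq \frac{s\log(ed/s)}{300\, n} \bigg) \geq 1 - 3\exp\Big(-\frac{s}{35}\Big) .$$
   Context: $\mathcal{P}_d$ is the set of probability vectors $P=(p_1,\dots,p_d)$ (with $p_j\ge 0$, $\sum_j p_j=1$), identified with probability distributions on $\{1,\dots,d\}$. $\mathcal{P}_{s,d}$ is the set of $P\in\mathcal{P}_d$ with $|\{j: p_j>0\}|\le s$. $X_1,\dots,X_n$ are i.i.d. with distribution $P$ and $\mathbb{P}_P$ is probability under this law. For $P,Q\in\mathcal{P}_d$, $\mathrm{KL}(P,Q)=\sum_{j=1}^d p_j\log(p_j/q_j)\in[0,+\infty]$, with the convention that a term is $0$ if $p_j=0$ and $+\infty$ if $p_j>0=q_j$. $\log$ is the natural logarithm and $e=\exp(1)$. *)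

theory Defs
  imports "HOL-Probability.Probability"
begin

definition prob_dists :: "nat \<Rightarrow> nat pmf set" where
  "prob_dists d = {P. set_pmf P \<subseteq> {1..d}}"

definition sparse_dists :: "nat \<Rightarrow> nat \<Rightarrow> nat pmf set" where
  "sparse_dists s d = {P \<in> prob_dists d. card {j \<in> {1..d}. pmf P j > 0} \<le> s}"

(* The library's KL_divergence is real-valued and so cannot take the value +infinity. *)
definition kl_term :: "real \<Rightarrow> real \<Rightarrow> ereal" where
  "kl_term p q = (if p = 0 then 0 else if q = 0 then \<infinity> else ereal (p * ln (p / q)))"

definition KL :: "nat \<Rightarrow> nat pmf \<Rightarrow> nat pmf \<Rightarrow> ereal" where
  "KL d P Q = (\<Sum>j = 1..d. kl_term (pmf P j) (pmf Q j))"

(* Joint law of X_1, ..., X_n; a sample is a function that is undefined outside {1..n},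
   so for P in prob_dists d the law is supported on {1..n} \<rightarrow>\<^sub>E {1..d}. *)
definition iid_sample :: "nat \<Rightarrow> nat pmf \<Rightarrow> (nat \<Rightarrow> nat) pmf" where
  "iid_sample n P = Pi_pmf {1..n} undefined (\<lambda>_. P)"

end

theory Submission
  imports Defs
begin

text \<open>
  For \<open>s \<le> 35\<close> the bound is vacuous. Otherwise put \<open>k = s - 1\<close> disjoint blocks of size
  \<open>m = d div s\<close> into \<open>{1..d}\<close> and let \<open>P\<close> have mass \<open>\<epsilon> = 1 / (10 n)\<close> at one point
  \<open>\<sigma> i\<close> of each block \<open>i\<close> and the remaining mass at \<open>d\<close>, where the \<open>\<sigma> i\<close> are independent and uniform.
  Condition on the block labels of the sample, and let \<open>U\<close> be the set of unseen blocks: the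
  estimate \<open>Q\<close> does not depend on \<open>\<sigma>\<close> on \<open>U\<close>. All summands of
  \<open>KL(P, Q) = (\<Sum>j. p\<^sub>j ln (p\<^sub>j / q\<^sub>j) - p\<^sub>j + q\<^sub>j)\<close> are nonnegative, and those of block
  \<open>i\<close> add up to \<open>- \<epsilon> ln (w i (\<sigma> i))\<close>, where \<open>w i j = (q\<^sub>i\<^sub>j / \<epsilon>) exp (1 - T i)\<close> and
  \<open>T i = (\<Sum>j. q\<^sub>i\<^sub>j / \<epsilon>)\<close>. Since \<open>(\<Sum>j. w i j) = T i exp (1 - T i) \<le> 1\<close>, the product of the
  \<open>w i (\<sigma> i)\<close> over \<open>U\<close> has mean at most \<open>m ^ (- card U)\<close>, so that by Markov
  \<open>KL(P, Q) < \<epsilon> r\<close> has conditional probability at most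
  \<open>min 1 (exp r * m ^ (- card U)) \<le> exp (r / ln m - card U)\<close>. Finally, \<open>card U\<close> is at least
  \<open>k\<close> minus the number of sample points in blocks, whose exponential moment is at most
  \<open>exp (k (e - 1) / 10)\<close>.
\<close>

section \<open>Lower bound on the divergence by blocks\<close>

lemma kl_summand_nonneg:
  fixes p q :: real
  assumes "0 \<le> p" "0 \<le> q" "p \<noteq> 0 \<Longrightarrow> q \<noteq> 0"
  shows "0 \<le> p * ln (p / q) - p + q"
proof (cases "p = 0")
  case False
  then have pq: "p > 0" "q > 0" using assms by auto
  have "ln (q / p) \<le> q / p - 1" using pq by (intro ln_le_minus_one) auto
  then have "p * ln (q / p) \<le> p * (q / p - 1)" using pq by (intro mult_left_mono) auto
  also have "\<dots> = q - p" using pq by (simp add: field_simps)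
  finally show ?thesis using pq by (simp add: ln_div algebra_simps)
qed (use assms in auto)

text \<open>Dropping the nonnegative summands outside the blocks of \<open>U\<close> leaves
  \<open>- \<epsilon> * (\<Sum>i\<in>U. ln (w i))\<close> as a lower bound for the divergence.
  Exponentiating gives a product over blocks, the form in which independence and Markov's inequality
  apply.\<close>

lemma exp_le_prod_if_KL_less:
  fixes \<sigma> :: "nat \<Rightarrow> nat" and c :: "nat \<Rightarrow> nat \<Rightarrow> nat"
  assumes P: "P \<in> prob_dists d" and Q: "Q \<in> prob_dists d" and fin: "finite U"
    and c: "inj_on (case_prod c) (U \<times> {..<m})" "case_prod c ` (U \<times> {..<m}) \<subseteq> {1..d}"
    and \<epsilon>: "\<epsilon> > 0"
    and \<sigma>: "\<And>i. i \<in> U \<Longrightarrow> \<sigma> i < m"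
    and mass: "\<And>i j. i \<in> U \<Longrightarrow> j < m \<Longrightarrow> pmf P (c i j) = (if j = \<sigma> i then \<epsilon> else 0)"
    and less: "KL d P Q < ereal (\<epsilon> * r)"
  shows "exp (- r) \<le> (\<Prod>i\<in>U. pmf Q (c i (\<sigma> i)) / \<epsilon> * exp (1 - (\<Sum>j<m. pmf Q (c i j)) / \<epsilon>))"
proof -
  define g where "g j = pmf P j * ln (pmf P j / pmf Q j)" for j
  define h where "h j = g j - pmf P j + pmf Q j" for j
  define w where "w i = pmf Q (c i (\<sigma> i)) / \<epsilon> * exp (1 - (\<Sum>j<m. pmf Q (c i j)) / \<epsilon>)" for i
  \<comment> \<open>A finite divergence forces \<open>Q\<close> to be positive wherever
    \<open>P\<close> is. This makes the real-valued \<open>g\<close> agree with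
    \<open>kl_term\<close>, which \<open>g\<close> could not do at an infinite term.\<close>
  have "KL d P Q \<noteq> \<infinity>" using less by auto
  then have "\<forall>j\<in>{1..d}. kl_term (pmf P j) (pmf Q j) \<noteq> \<infinity>"
    unfolding KL_def sum_Pinfty by auto
  then have ac: "pmf Q j \<noteq> 0" if "j \<in> {1..d}" "pmf P j \<noteq> 0" for j
    using that unfolding kl_term_def by (auto split: if_splits)
  have "KL d P Q = (\<Sum>j = 1..d. ereal (g j))"
    unfolding KL_def by (rule sum.cong) (use ac in \<open>auto simp: kl_term_def g_def\<close>)
  then have g_less: "(\<Sum>j = 1..d. g j) < \<epsilon> * r" using less by simp
  have tot: "(\<Sum>j = 1..d. pmf R j) = 1" if "R \<in> prob_dists d" for R
    using that by (intro sum_pmf_eq_1) (auto simp: prob_dists_def)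
  have h_nonneg: "h j \<ge> 0" if "j \<in> {1..d}" for j
    using ac that unfolding h_def g_def by (intro kl_summand_nonneg) auto
  have block: "(\<Sum>j<m. h (c i j)) = - \<epsilon> * ln (w i)" and w_pos: "w i > 0" if i: "i \<in> U" for i
  proof -
    have "c i (\<sigma> i) \<in> {1..d}" using c(2) i \<sigma>[OF i] by auto
    then have q: "pmf Q (c i (\<sigma> i)) > 0"
      using ac mass[OF i \<sigma>[OF i]] \<epsilon> by (simp add: pmf_pos)
    show "w i > 0" using q \<epsilon> by (simp add: w_def)
    \<comment> \<open>Away from \<open>\<sigma> i\<close> a summand is just the mass of
      \<open>Q\<close>. These masses and the \<open>- \<epsilon>\<close> at
      \<open>\<sigma> i\<close> together form the factor \<open>exp (1 - T i)\<close> of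
      \<open>w i\<close>.\<close>
    have "(\<Sum>j<m. h (c i j))
        = (\<Sum>j<m. (if j = \<sigma> i then \<epsilon> * ln (\<epsilon> / pmf Q (c i (\<sigma> i))) - \<epsilon> else 0) + pmf Q (c i j))"
      using mass[OF i] by (intro sum.cong) (auto simp: h_def g_def)
    also have "\<dots> = \<epsilon> * ln (\<epsilon> / pmf Q (c i (\<sigma> i))) - \<epsilon> + (\<Sum>j<m. pmf Q (c i j))"
      using \<sigma>[OF i] by (simp add: sum.distrib)
    also have "\<dots> = - \<epsilon> * ln (w i)"
      using q \<epsilon> by (simp add: w_def ln_mult ln_div field_simps)
    finally show "(\<Sum>j<m. h (c i j)) = - \<epsilon> * ln (w i)" .
  qed
  have "- \<epsilon> * (\<Sum>i\<in>U. ln (w i)) = (\<Sum>i\<in>U. \<Sum>j<m. h (c i j))"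
    using block by (simp add: sum_distrib_left)
  also have "\<dots> = (\<Sum>x\<in>U \<times> {..<m}. h (case_prod c x))"
    by (subst sum.cartesian_product) (simp add: case_prod_unfold)
  also have "\<dots> = (\<Sum>j\<in>case_prod c ` (U \<times> {..<m}). h j)"
    using sum.reindex[OF c(1), of h] by (simp add: comp_def)
  also have "\<dots> \<le> (\<Sum>j = 1..d. h j)"
    using c(2) h_nonneg by (intro sum_mono2) auto
  \<comment> \<open>Both distributions have total mass one, so the corrections
    \<open>- p + q\<close> cancel over all of \<open>{1..d}\<close>.\<close>
  also have "\<dots> = (\<Sum>j = 1..d. g j)"
    using tot[OF P] tot[OF Q] by (simp add: h_def sum.distrib sum_subtractf)
  also have "\<dots> \<le> \<epsilon> * r" using g_less by simp
  finally have "\<epsilon> * (- r) \<le> \<epsilon> * (\<Sum>i\<in>U. ln (w i))" by simp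
  then have "- r \<le> (\<Sum>i\<in>U. ln (w i))" using \<epsilon> by (simp only: mult_le_cancel_left_pos)
  then have "exp (- r) \<le> exp (\<Sum>i\<in>U. ln (w i))" by simp
  also have "\<dots> = (\<Prod>i\<in>U. w i)" using w_pos fin by (simp add: exp_sum)
  finally show ?thesis by (simp add: w_def)
qed

section \<open>Products of weights at independent uniform positions\<close>

lemma pmf_bind_le:
  assumes "\<And>x. x \<in> set_pmf M \<Longrightarrow> pmf (f x) i \<le> B"
  shows "pmf (bind_pmf M f) i \<le> B"
proof -
  have "integrable (measure_pmf M) (\<lambda>x. pmf (f x) i)"
    by (intro measure_pmf.integrable_const_bound[where B = 1]) (auto simp: pmf_le_1)
  then have "(\<integral>x. pmf (f x) i \<partial>measure_pmf M) \<le> (\<integral>x. B \<partial>measure_pmf M)"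
    using assms by (intro integral_mono_AE) (auto simp: AE_measure_pmf_iff)
  then show ?thesis by (simp add: pmf_bind)
qed

lemma prob_prod_uniform_ge:
  fixes w :: "(nat \<Rightarrow> nat) \<Rightarrow> nat \<Rightarrow> nat \<Rightarrow> real"
  assumes fin: "finite U" "finite V" and disj: "V \<inter> U = {}" and "m > 0" and "c > 0"
    and nonneg: "\<And>\<sigma> i j. 0 \<le> w \<sigma> i j"
    and le1: "\<And>\<sigma> i. i \<in> U \<Longrightarrow> (\<Sum>j<m. w \<sigma> i j) \<le> 1"
    and dep: "\<And>\<sigma> \<tau>. (\<forall>i\<in>V. \<sigma> i = \<tau> i) \<Longrightarrow> w \<sigma> = w \<tau>"
  shows "measure_pmf.prob (Pi_pmf (V \<union> U) 0 (\<lambda>_. pmf_of_set {..<m}))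
           {\<sigma>. c \<le> (\<Prod>i\<in>U. w \<sigma> i (\<sigma> i))} \<le> 1 / (c * real m ^ card U)"
proof -
  let ?u = "\<lambda>_. pmf_of_set {..<m}"
  let ?A = "\<lambda>\<sigma>. c \<le> (\<Prod>i\<in>U. w \<sigma> i (\<sigma> i))"
  let ?j = "\<lambda>f g x. if x \<in> V then f x else g x"
  have ne: "{..<m} \<noteq> {}" using \<open>m > 0\<close> by (auto simp: lessThan_empty_iff)
  \<comment> \<open>An event is written as the mass at \<open>True\<close> of a Boolean pmf, so that
    conditioning on the coordinates in \<open>V\<close> becomes a \<open>bind_pmf\<close>.\<close>
  have "measure_pmf.prob (Pi_pmf (V \<union> U) 0 ?u) {\<sigma>. ?A \<sigma>}
      = pmf (map_pmf ?A (Pi_pmf (V \<union> U) 0 ?u)) True"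
    by (simp add: pmf_map vimage_def)
  also have "map_pmf ?A (Pi_pmf (V \<union> U) 0 ?u)
      = bind_pmf (Pi_pmf V 0 ?u) (\<lambda>f. map_pmf (\<lambda>g. ?A (?j f g)) (Pi_pmf U 0 ?u))"
    unfolding Pi_pmf_union[OF fin(2,1) disj]
    by (simp add: pair_pmf_def map_pmf_def bind_assoc_pmf bind_return_pmf)
  also have "pmf \<dots> True \<le> 1 / (c * real m ^ card U)"
  proof (rule pmf_bind_le)
    fix f
    define v where "v = w f"
    have v: "(\<Prod>i\<in>U. w (?j f g) i (?j f g i)) = (\<Prod>i\<in>U. v i (g i))" for g
      using disj dep[of "?j f g" f] by (intro prod.cong) (auto simp: v_def)
    have int: "integrable (measure_pmf (Pi_pmf U 0 ?u)) F" for F :: "(nat \<Rightarrow> nat) \<Rightarrow> real"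
      using fin ne by (intro integrable_measure_pmf_finite) 
        (auto simp: set_Pi_pmf intro!: finite_PiE_dflt)
    have "measure_pmf.expectation (Pi_pmf U 0 ?u) (\<lambda>g. \<Prod>i\<in>U. v i (g i))
        = (\<Prod>i\<in>U. measure_pmf.expectation (pmf_of_set {..<m}) (v i))"
      using fin ne by (intro expectation_prod_Pi_pmf integrable_measure_pmf_finite)
        (auto simp: v_def nonneg)
    also have "\<dots> = (\<Prod>i\<in>U. (\<Sum>j<m. v i j) / real m)"
      using ne by (simp add: integral_pmf_of_set)
    also have "\<dots> \<le> (\<Prod>i\<in>U. 1 / real m)"
      using le1 nonneg by (intro prod_mono) (auto simp: v_def intro!: divide_right_mono sum_nonneg divide_nonneg_nonneg)
    finally have E: "measure_pmf.expectation (Pi_pmf U 0 ?u) (\<lambda>g. \<Prod>i\<in>U. v i (g i)) \<le> 1 / real m ^ card U"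
      by (simp add: power_one_over)
    have "pmf (map_pmf (\<lambda>g. ?A (?j f g)) (Pi_pmf U 0 ?u)) True
        = measure_pmf.prob (Pi_pmf U 0 ?u) {g. c \<le> (\<Prod>i\<in>U. v i (g i))}"
      by (simp add: pmf_map vimage_def v)
    also have "\<dots> \<le> measure_pmf.expectation (Pi_pmf U 0 ?u) (\<lambda>g. \<Prod>i\<in>U. v i (g i)) / c"
      using integral_Markov_inequality_measure[of "measure_pmf (Pi_pmf U 0 ?u)" _ "{}" c, OF int] \<open>c > 0\<close>
      by (simp add: nonneg v_def prod_nonneg)
    also have "\<dots> \<le> (1 / real m ^ card U) / c"
      using E \<open>c > 0\<close> by (intro divide_right_mono) auto
    finally show "pmf (map_pmf (\<lambda>g. ?A (?j f g)) (Pi_pmf U 0 ?u)) True \<le> 1 / (c * real m ^ card U)"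
      by (simp add: mult.commute)
  qed
  finally show ?thesis .
qed

section \<open>The random sparse distribution and its samples\<close>

definition label_pmf :: "nat \<Rightarrow> real \<Rightarrow> nat pmf" where
  "label_pmf k p = bind_pmf (bernoulli_pmf p) (\<lambda>b. if b then pmf_of_set {..<k} else return_pmf k)"

lemma pmf_label_pmf:
  assumes "0 < k" "0 \<le> p" "p \<le> 1"
  shows "pmf (label_pmf k p) l = (if l < k then p / real k else if l = k then 1 - p else 0)"
proof -
  have "{..<k} \<noteq> {}" using assms by (auto simp: lessThan_empty_iff)
  then show ?thesis
    using assms by (auto simp: label_pmf_def pmf_bind indicator_def)
qed

lemma set_label_pmf:
  assumes "0 < k" "0 \<le> p" "p \<le> 1"
  shows "set_pmf (label_pmf k p) \<subseteq> {..k}"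
  using assms by (auto simp: set_pmf_eq pmf_label_pmf split: if_splits)

text \<open>Block \<open>l\<close> occupies the points \<open>l * m + 1\<close> to
  \<open>l * m + m\<close>, shifted by one because the points start at 1. The label \<open>k\<close>
  stands for the remaining mass and goes to \<open>d\<close>, which lies beyond all blocks when
  \<open>k * m < d\<close>.\<close>

definition place :: "nat \<Rightarrow> nat \<Rightarrow> nat \<Rightarrow> (nat \<Rightarrow> nat) \<Rightarrow> nat \<Rightarrow> nat" where
  "place k m d \<sigma> l = (if l < k then l * m + \<sigma> l + 1 else d)"

text \<open>The law of the labels does not involve \<open>\<sigma>\<close>. Writing the distribution
  as its image allows labels and positions to be drawn in either order.\<close>

definition spiked :: "nat \<Rightarrow> nat \<Rightarrow> nat \<Rightarrow> real \<Rightarrow> (nat \<Rightarrow> nat) \<Rightarrow> nat pmf" where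
  "spiked k m d p \<sigma> = map_pmf (place k m d \<sigma>) (label_pmf k p)"

lemma block_le:
  fixes i j k m :: nat
  assumes "i < k" "j < m"
  shows "i * m + j + 1 \<le> k * m"
proof -
  have "i * m + m \<le> k * m" using assms(1) mult_le_mono1[of "Suc i" k m] by simp
  then show ?thesis using assms by linarith
qed

lemma block_eqD:
  fixes i j m :: nat
  assumes "i * m + j + 1 = i' * m + j' + 1" "j < m" "j' < m"
  shows "i = i' \<and> j = j'"
proof -
  have "i * m + j = i' * m + j'" using assms by simp
  then have "(i * m + j) div m = (i' * m + j') div m" "(i * m + j) mod m = (i' * m + j') mod m" by auto
  then show ?thesis using assms by auto
qed

context
  fixes k m d :: nat and p :: real and \<sigma> :: "nat \<Rightarrow> nat"
  assumes k: "0 < k" and p: "0 \<le> p" "p \<le> 1" and km: "k * m < d"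
    and \<sigma>: "\<And>i. i < k \<Longrightarrow> \<sigma> i < m"
begin

lemma place_mem: "place k m d \<sigma> l \<in> {1..d}"
  using km block_le[of l k "\<sigma> l" m] \<sigma>[of l] by (auto simp: place_def)

lemma inj_on_place: "inj_on (place k m d \<sigma>) {..k}"
proof (rule inj_onI)
  fix a b assume *: "a \<in> {..k}" "b \<in> {..k}" "place k m d \<sigma> a = place k m d \<sigma> b"
  show "a = b"
    using * km block_le[of a k "\<sigma> a" m] block_le[of b k "\<sigma> b" m] \<sigma>[of a] \<sigma>[of b]
      block_eqD[of a m "\<sigma> a" b "\<sigma> b"]
    by (auto simp: place_def split: if_splits)
qed

lemma set_spiked: "set_pmf (spiked k m d p \<sigma>) \<subseteq> place k m d \<sigma> ` {..k}"
  using set_label_pmf[OF k p] by (auto simp: spiked_def)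

lemma spiked_sparse: "spiked k m d p \<sigma> \<in> sparse_dists (Suc k) d"
proof -
  have "card {j \<in> {1..d}. pmf (spiked k m d p \<sigma>) j > 0} \<le> card (place k m d \<sigma> ` {..k})"
    using set_spiked by (intro card_mono) (auto simp: pmf_positive_iff)
  also have "\<dots> \<le> Suc k" using card_image_le[of "{..k}" "place k m d \<sigma>"] by simp
  finally show ?thesis
    using set_spiked place_mem by (auto simp: sparse_dists_def prob_dists_def)
qed

lemma pmf_spiked:
  assumes "i < k" "j < m"
  shows "pmf (spiked k m d p \<sigma>) (i * m + j + 1) = (if j = \<sigma> i then p / real k else 0)"
proof (cases "j = \<sigma> i")
  case True
  have "pmf (spiked k m d p \<sigma>) (place k m d \<sigma> i) = measure_pmf.prob (label_pmf k p) {i}"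
    unfolding spiked_def pmf_map
  proof (rule measure_pmf.finite_measure_eq_AE)
    show "AE x in measure_pmf (label_pmf k p). (x \<in> place k m d \<sigma> -` {place k m d \<sigma> i}) = (x \<in> {i})"
      using set_label_pmf[OF k p] inj_onD[OF inj_on_place] assms
      by (auto simp: AE_measure_pmf_iff)
  qed auto
  then show ?thesis
    using True assms k p by (simp add: place_def measure_pmf_single pmf_label_pmf)
next
  case False
  have "place k m d \<sigma> l \<noteq> i * m + j + 1" if "l \<le> k" for l
    using False that assms km block_le[OF assms] \<sigma>[of l] block_eqD[of l m "\<sigma> l" i j]
    by (auto simp: place_def)
  then have "i * m + j + 1 \<notin> set_pmf (spiked k m d p \<sigma>)"
    using set_spiked by force
  then show ?thesis using False by (simp add: set_pmf_iff)
qed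

end

text \<open>Turns a sample into a function of independent labels. Mapping a product law sends its
  default \<open>a\<close> to \<open>f a\<close>, so the value outside \<open>{1..n}\<close> has to
  be reset to \<open>undefined\<close>.\<close>

lemma iid_sample_map_pmf:
  "iid_sample n (map_pmf f M)
     = map_pmf (\<lambda>L x. if x \<in> {1..n} then f (L x) else undefined) (Pi_pmf {1..n} a (\<lambda>_. M))"
proof -
  have "iid_sample n (map_pmf f M)
      = map_pmf (\<lambda>g x. if x \<in> {1..n} then g x else undefined) (Pi_pmf {1..n} (f a) (\<lambda>_. map_pmf f M))"
    unfolding iid_sample_def by (rule Pi_pmf_default_swap[symmetric]) simp
  also have "Pi_pmf {1..n} (f a) (\<lambda>_. map_pmf f M) = map_pmf (\<lambda>L. f \<circ> L) (Pi_pmf {1..n} a (\<lambda>_. M))"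
    by (rule Pi_pmf_map) auto
  finally show ?thesis by (simp add: map_pmf_comp comp_def cong: if_cong)
qed


section \<open>Small divergence given the labels\<close>

lemma times_exp_le_1: "x * exp (1 - x) \<le> (1::real)"
proof -
  have "x \<le> exp (x - 1)" using exp_ge_add_one_self[of "x - 1"] by simp
  then have "x * exp (1 - x) \<le> exp (x - 1) * exp (1 - x)" by (intro mult_right_mono) auto
  then show ?thesis by (simp flip: exp_add)
qed

lemma exists_le_of_bind:
  assumes "pmf (bind_pmf M f) i \<le> B"
  shows "\<exists>x\<in>set_pmf M. pmf (f x) i \<le> B"
proof (rule ccontr)
  assume "\<not> ?thesis"
  then have "AE x in measure_pmf M. B < pmf (f x) i" by (auto simp: AE_measure_pmf_iff)
  moreover have "integrable (measure_pmf M) (\<lambda>x. pmf (f x) i)"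
    by (intro measure_pmf.integrable_const_bound[where B = 1]) (auto simp: pmf_le_1)
  ultimately have "B < (\<integral>x. pmf (f x) i \<partial>measure_pmf M)"
    by (intro measure_pmf.expectation_greater)
  then show False using assms by (simp add: pmf_bind)
qed

text \<open>Here the labels \<open>L\<close> are fixed and only the positions
  \<open>\<sigma>\<close> are random. The bound is a product over sample points instead of a power
  in \<open>card U\<close>, so that its mean under independent labels factorizes.\<close>

lemma prob_KL_less_labels:
  fixes \<Phi> :: "(nat \<Rightarrow> nat) \<Rightarrow> nat pmf" and L :: "nat \<Rightarrow> nat" and d k m n :: nat and p r :: real
  defines "X \<equiv> \<lambda>\<sigma> x. if x \<in> {1..n} then place k m d \<sigma> (L x) else undefined"
  assumes k: "0 < k" and p: "0 < p" "p \<le> 1" and km: "k * m < d" and m: "3 \<le> m"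
    and \<Phi>: "\<Phi> \<in> ({1..n} \<rightarrow>\<^sub>E {1..d}) \<rightarrow> prob_dists d"
  shows "measure_pmf.prob (Pi_pmf {..<k} 0 (\<lambda>_. pmf_of_set {..<m}))
           {\<sigma>. KL d (spiked k m d p \<sigma>) (\<Phi> (X \<sigma>)) < ereal (p / real k * r)}
         \<le> exp (r / ln (real m) - real k) * (\<Prod>x = 1..n. if L x < k then exp 1 else 1)"
proof -
  define U where "U = {l. l < k \<and> l \<notin> L ` {1..n}}"
  define V where "V = L ` {x \<in> {1..n}. L x < k}"
  define \<epsilon> where "\<epsilon> = p / real k"
  define T where "T \<sigma> i = (\<Sum>j<m. pmf (\<Phi> (X \<sigma>)) (i * m + j + 1)) / \<epsilon>" for \<sigma> i
  define w where "w \<sigma> i j = pmf (\<Phi> (X \<sigma>)) (i * m + j + 1) / \<epsilon> * exp (1 - T \<sigma> i)" for \<sigma> i j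
  let ?M = "Pi_pmf {..<k} 0 (\<lambda>_. pmf_of_set {..<m})"
  let ?B = "{\<sigma>. KL d (spiked k m d p \<sigma>) (\<Phi> (X \<sigma>)) < ereal (\<epsilon> * r)}"
  have \<epsilon>: "\<epsilon> > 0" using k p by (simp add: \<epsilon>_def)
  have fin: "finite U" "finite V" and disj: "V \<inter> U = {}" and un: "V \<union> U = {..<k}"
    by (auto simp: U_def V_def)
  have ne: "{..<m} \<noteq> {}" using m by (auto simp: lessThan_empty_iff)
  have "measure_pmf.prob ?M ?B \<le> measure_pmf.prob ?M {\<sigma>. exp (- r) \<le> (\<Prod>i\<in>U. w \<sigma> i (\<sigma> i))}"
  proof (rule measure_pmf.finite_measure_mono_AE)
    have "exp (- r) \<le> (\<Prod>i\<in>U. w \<sigma> i (\<sigma> i))"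
      if "\<sigma> \<in> set_pmf ?M" and less: "KL d (spiked k m d p \<sigma>) (\<Phi> (X \<sigma>)) < ereal (\<epsilon> * r)" for \<sigma>
    proof -
      have \<sigma>: "\<sigma> i < m" if "i < k" for i
        using that \<open>\<sigma> \<in> set_pmf ?M\<close> ne by (auto simp: set_Pi_pmf PiE_dflt_def)
      have "X \<sigma> \<in> {1..n} \<rightarrow>\<^sub>E {1..d}"
        using place_mem[OF k _ p(2) km \<sigma>] p by (auto simp: X_def)
      then have Q: "\<Phi> (X \<sigma>) \<in> prob_dists d" using \<Phi> by auto
      have P: "spiked k m d p \<sigma> \<in> prob_dists d"
        using spiked_sparse[OF k _ p(2) km \<sigma>] p by (auto simp: sparse_dists_def)
      show ?thesis
        unfolding w_def T_def
      proof (rule exp_le_prod_if_KL_less[OF P Q fin(1) _ _ \<epsilon> _ _ less])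
        show "inj_on (\<lambda>(i, j). i * m + j + 1) (U \<times> {..<m})"
        proof (rule inj_onI)
          fix x y
          assume "x \<in> U \<times> {..<m}" "y \<in> U \<times> {..<m}"
            "(\<lambda>(i, j). i * m + j + 1) x = (\<lambda>(i, j). i * m + j + 1) y"
          then show "x = y"
            using block_eqD[of "fst x" m "snd x" "fst y" "snd y"]
            by (simp add: case_prod_unfold mem_Times_iff prod_eq_iff)
        qed
        show "(\<lambda>(i, j). i * m + j + 1) ` (U \<times> {..<m}) \<subseteq> {1..d}"
          using block_le[of _ k _ m] km by (fastforce simp: U_def)
        show "pmf (spiked k m d p \<sigma>) (i * m + j + 1) = (if j = \<sigma> i then \<epsilon> else 0)"
          if "i \<in> U" "j < m" for i j
          unfolding \<epsilon>_def using that p by (intro pmf_spiked k km \<sigma>) (auto simp: U_def)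
      qed (auto simp: U_def \<sigma>)
    qed
    then show "AE \<sigma> in measure_pmf ?M. \<sigma> \<in> ?B \<longrightarrow> \<sigma> \<in> {\<sigma>. exp (- r) \<le> (\<Prod>i\<in>U. w \<sigma> i (\<sigma> i))}"
      by (auto simp: AE_measure_pmf_iff)
  qed auto
  also have "\<dots> \<le> 1 / (exp (- r) * real m ^ card U)"
    unfolding un[symmetric]
  proof (rule prob_prod_uniform_ge[OF fin disj])
    show "0 \<le> w \<sigma> i j" for \<sigma> i j using \<epsilon> by (simp add: w_def)
    show "(\<Sum>j<m. w \<sigma> i j) \<le> 1" for \<sigma> i
      using times_exp_le_1[of "T \<sigma> i"]
      by (simp add: w_def T_def flip: sum_distrib_right sum_divide_distrib)
    \<comment> \<open>The weights depend on \<open>\<sigma>\<close> only through the sample, which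
      reads \<open>\<sigma>\<close> only at the block labels occurring in \<open>L\<close>.\<close>
    show "w \<sigma> = w \<tau>" if "\<forall>i\<in>V. \<sigma> i = \<tau> i" for \<sigma> \<tau>
    proof -
      have "X \<sigma> = X \<tau>" using that by (auto simp: X_def V_def place_def)
      then show ?thesis by (intro ext) (simp only: w_def T_def)
    qed
  qed (use m in auto)
  also have "\<dots> = exp (r - real (card U) * ln (real m))"
    using m by (simp add: exp_diff exp_minus exp_of_nat_mult field_simps)
  finally have prob_le: "measure_pmf.prob ?M ?B \<le> exp (r - real (card U) * ln (real m))" .
  have "exp 1 \<le> real m" using exp_le m by linarith
  then have ln_m: "1 \<le> ln (real m)" using m by (simp add: ln_ge_iff)
  \<comment> \<open>Since \<open>ln m \<ge> 1\<close>, dividing a nonpositive exponent by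
    \<open>ln m\<close> only increases it. If the exponent is positive, the new bound exceeds one
    and is trivial.\<close>
  have "measure_pmf.prob ?M ?B \<le> exp (r / ln (real m) - real (card U))"
  proof (cases "r \<le> real (card U) * ln (real m)")
    case True
    have "(real (card U) * ln (real m) - r) / ln (real m) \<le> real (card U) * ln (real m) - r"
      using divide_left_mono[OF ln_m, of "real (card U) * ln (real m) - r"] True ln_m by simp
    then have "r - real (card U) * ln (real m) \<le> r / ln (real m) - real (card U)"
      using ln_m by (simp add: diff_divide_distrib)
    then show ?thesis using prob_le by (meson exp_le_cancel_iff order_trans)
  next
    case False
    then have "0 \<le> r / ln (real m) - real (card U)" using ln_m by (simp add: field_simps)
    then have "1 \<le> exp (r / ln (real m) - real (card U))" by simp
    then show ?thesis using measure_pmf.prob_le_1[of ?M ?B] by linarith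
  qed
  \<comment> \<open>Each seen block accounts for at least one sample point with a block
    label.\<close>
  also have "real k \<le> real (card U) + (\<Sum>x = 1..n. if L x < k then 1 else 0)"
  proof -
    have "k = card V + card U" using card_Un_disjoint[OF fin(2,1) disj] un by simp
    moreover have "card V \<le> card {x \<in> {1..n}. L x < k}" unfolding V_def by (rule card_image_le) simp
    moreover have "(\<Sum>x = 1..n. if L x < k then 1 else 0) = real (card {x \<in> {1..n}. L x < k})"
      by (simp add: sum.If_cases Int_def)
    ultimately show ?thesis by simp
  qed
  then have "exp (r / ln (real m) - real (card U))
      \<le> exp (r / ln (real m) - real k + (\<Sum>x = 1..n. if L x < k then 1 else 0))" by simp
  also have "\<dots> = exp (r / ln (real m) - real k) * (\<Prod>x = 1..n. if L x < k then exp 1 else 1)"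
    by (simp add: exp_add exp_sum if_distrib cong: if_cong)
  finally show ?thesis by (simp add: \<epsilon>_def)
qed

section \<open>Averaging over the labels and fixing the positions\<close>

lemma expectation_exp_labels:
  assumes k: "0 < k" and p: "0 \<le> p" "p \<le> 1"
  shows "measure_pmf.expectation (Pi_pmf {1..n} a (\<lambda>_. label_pmf k p))
           (\<lambda>L. \<Prod>x = 1..n. if L x < k then exp 1 else 1) \<le> exp (real n * p * (exp 1 - 1))"
proof -
  have fin: "finite (set_pmf (label_pmf k p))"
    using set_label_pmf[OF assms] by (rule finite_subset) simp
  have atMost: "{..k} = insert k {..<k}" by auto
  \<comment> \<open>The number of sample points in blocks is binomial with parameters
    \<open>n\<close> and \<open>p\<close>. This is the contribution of one point to its moment
    generating function at 1.\<close>
  have "measure_pmf.expectation (label_pmf k p) (\<lambda>l. if l < k then exp 1 else 1)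
      = (\<Sum>l\<in>{..k}. (if l < k then exp 1 else 1) * pmf (label_pmf k p) l)"
    using set_label_pmf[OF assms] by (intro integral_measure_pmf_real) auto
  also have "\<dots> = 1 + p * (exp 1 - 1)"
    unfolding atMost using k by (simp add: pmf_label_pmf[OF assms] algebra_simps)
  also have "\<dots> \<le> exp (p * (exp 1 - 1))" by (rule exp_ge_add_one_self)
  finally have E: "measure_pmf.expectation (label_pmf k p) (\<lambda>l. if l < k then exp 1 else 1)
      \<le> exp (p * (exp 1 - 1))" .
  have "measure_pmf.expectation (Pi_pmf {1..n} a (\<lambda>_. label_pmf k p))
      (\<lambda>L. \<Prod>x = 1..n. if L x < k then exp 1 else (1::real))
    = (\<Prod>x = 1..n. measure_pmf.expectation (label_pmf k p) (\<lambda>l. if l < k then exp 1 else 1))"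
    using fin by (intro expectation_prod_Pi_pmf integrable_measure_pmf_finite) auto
  also have "\<dots> \<le> (\<Prod>x = 1..n. exp (p * (exp 1 - 1)))"
    using E by (intro prod_mono) (auto intro!: integral_nonneg_AE)
  also have "\<dots> = exp (real n * p * (exp 1 - 1))"
    by (simp add: mult.assoc flip: exp_of_nat_mult)
  finally show ?thesis .
qed

text \<open>Probabilistic method: the bound holds on average over random positions, hence for some
  \<open>\<sigma>\<close>. Exchanging the two draws makes the inner probability one over positions
  with labels fixed.\<close>

lemma exists_spiked_prob_KL_less:
  fixes \<Phi> :: "(nat \<Rightarrow> nat) \<Rightarrow> nat pmf" and d k m n :: nat and p r :: real
  assumes k: "0 < k" and p: "0 < p" "p \<le> 1" and km: "k * m < d" and m: "3 \<le> m"
    and \<Phi>: "\<Phi> \<in> ({1..n} \<rightarrow>\<^sub>E {1..d}) \<rightarrow> prob_dists d"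
  shows "\<exists>P \<in> sparse_dists (Suc k) d.
    measure_pmf.prob (iid_sample n P) {x. KL d P (\<Phi> x) < ereal (p / real k * r)}
    \<le> exp (r / ln (real m) - real k + real n * p * (exp 1 - 1))"
proof -
  let ?M = "Pi_pmf {..<k} 0 (\<lambda>_. pmf_of_set {..<m})"
  let ?N = "Pi_pmf {1..n} 0 (\<lambda>_. label_pmf k p)"
  let ?X = "\<lambda>\<sigma> L x. if x \<in> {1..n} then place k m d \<sigma> (L x) else undefined"
  let ?B = "\<lambda>\<sigma> x. KL d (spiked k m d p \<sigma>) (\<Phi> x) < ereal (p / real k * r)"
  let ?F = "\<lambda>L. \<Prod>x = 1..n. if L x < k then exp 1 else (1::real)"
  let ?b = "exp (r / ln (real m) - real k)"
  have "pmf (bind_pmf ?M (\<lambda>\<sigma>. map_pmf (\<lambda>L. ?B \<sigma> (?X \<sigma> L)) ?N)) True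
      = pmf (bind_pmf ?N (\<lambda>L. map_pmf (\<lambda>\<sigma>. ?B \<sigma> (?X \<sigma> L)) ?M)) True"
    unfolding map_pmf_def by (subst bind_commute_pmf) simp
  also have "\<dots> = measure_pmf.expectation ?N (\<lambda>L. pmf (map_pmf (\<lambda>\<sigma>. ?B \<sigma> (?X \<sigma> L)) ?M) True)"
    by (rule pmf_bind)
  also have "\<dots> \<le> measure_pmf.expectation ?N (\<lambda>L. ?b * ?F L)"
  proof (rule integral_mono)
    have "finite (set_pmf ?N)"
      using set_label_pmf[of k p] k p
      by (auto simp: set_Pi_pmf intro!: finite_PiE_dflt intro: finite_subset)
    then show "integrable (measure_pmf ?N) (\<lambda>L. pmf (map_pmf (\<lambda>\<sigma>. ?B \<sigma> (?X \<sigma> L)) ?M) True)"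
      "integrable (measure_pmf ?N) (\<lambda>L. ?b * ?F L)"
      by (auto intro: integrable_measure_pmf_finite)
    show "pmf (map_pmf (\<lambda>\<sigma>. ?B \<sigma> (?X \<sigma> L)) ?M) True \<le> ?b * ?F L" for L
      using prob_KL_less_labels[OF assms] by (simp add: pmf_map vimage_def)
  qed
  also have "\<dots> = ?b * measure_pmf.expectation ?N ?F" by simp
  also have "\<dots> \<le> ?b * exp (real n * p * (exp 1 - 1))"
    using expectation_exp_labels[of k p] k p by (intro mult_left_mono) auto
  also have "\<dots> = exp (r / ln (real m) - real k + real n * p * (exp 1 - 1))"
    by (simp add: exp_add)
  finally have le: "pmf (bind_pmf ?M (\<lambda>\<sigma>. map_pmf (\<lambda>L. ?B \<sigma> (?X \<sigma> L)) ?N)) True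
      \<le> exp (r / ln (real m) - real k + real n * p * (exp 1 - 1))" .
  \<comment> \<open>Taking \<open>\<sigma>\<close> from the support keeps each
    \<open>\<sigma> i\<close> inside its block.\<close>
  obtain \<sigma> where \<sigma>_set: "\<sigma> \<in> set_pmf ?M"
    and \<sigma>: "pmf (map_pmf (\<lambda>L. ?B \<sigma> (?X \<sigma> L)) ?N) True
      \<le> exp (r / ln (real m) - real k + real n * p * (exp 1 - 1))"
    by (rule bexE[OF exists_le_of_bind[OF le]])
  have ne: "{..<m} \<noteq> {}" using m by (auto simp: lessThan_empty_iff)
  have "\<sigma> i < m" if "i < k" for i
    using that \<sigma>_set ne by (auto simp: set_Pi_pmf PiE_dflt_def)
  then have "spiked k m d p \<sigma> \<in> sparse_dists (Suc k) d"
    using p by (intro spiked_sparse k km) auto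
  moreover have "measure_pmf.prob (iid_sample n (spiked k m d p \<sigma>)) {x. ?B \<sigma> x}
      = pmf (map_pmf (\<lambda>L. ?B \<sigma> (?X \<sigma> L)) ?N) True"
    unfolding spiked_def[of k m d p \<sigma>] iid_sample_map_pmf[of n _ _ 0]
    by (simp add: pmf_map vimage_def)
  ultimately show ?thesis using \<sigma> by (intro bexI[of _ "spiked k m d p \<sigma>"]) simp_all
qed

section \<open>Choice of the parameters\<close>

lemma sparse_dists_nonempty:
  assumes "1 \<le> s" "1 \<le> d"
  shows "\<exists>P. P \<in> sparse_dists s d"
proof -
  have "{j \<in> {1..d}. pmf (return_pmf 1) j > 0} = {1}"
    using assms by (auto simp: indicator_def split: if_splits)
  then have "return_pmf 1 \<in> sparse_dists s d"
    using assms by (auto simp: sparse_dists_def prob_dists_def)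
  then show ?thesis by blast
qed

theorem proposition1:
  fixes n d s :: nat and \<Phi> :: "(nat \<Rightarrow> nat) \<Rightarrow> nat pmf"
  assumes "n \<ge> 2" and "d \<ge> 2"
    and "1 \<le> s" and "real s \<le> min (real n) (real d / 55)"
    and "\<Phi> \<in> ({1..n} \<rightarrow>\<^sub>E {1..d}) \<rightarrow> prob_dists d"
  shows "\<exists>P \<in> sparse_dists s d.
    measure_pmf.prob (iid_sample n P)
      {x. KL d P (\<Phi> x) \<ge> ereal (real s * ln (exp 1 * real d / real s) / (300 * real n))}
    \<ge> 1 - 3 * exp (- (real s / 35))"
proof (cases "s \<le> 35")
  case True
  obtain P where P: "P \<in> sparse_dists s d" using sparse_dists_nonempty assms by fastforce
  \<comment> \<open>As \<open>e \<le> 3\<close>, the claimed probability is at most 0 and any sparse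
    distribution serves.\<close>
  have "exp (real s / 35) \<le> exp 1" using True by simp
  also have "\<dots> \<le> 3" by (rule exp_le)
  finally have "1 - 3 * exp (- (real s / 35)) \<le> 0" by (simp add: exp_minus field_simps)
  then show ?thesis using P order_trans[OF _ measure_nonneg] by blast
next
  case False
  \<comment> \<open>One of the \<open>s\<close> support points is reserved for \<open>d\<close>. The
    value of \<open>p\<close> makes each spike \<open>p / k = 1 / (10 n)\<close>, and
    \<open>r\<close> is chosen so that \<open>p / k * r\<close> is the threshold
    \<open>?e\<close>.\<close>
  define k where "k = s - 1"
  define m where "m = d div s"
  define p where "p = real k / (10 * real n)"
  define r where "r = real s * ln (exp 1 * real d / real s) / 30"
  let ?e = "real s * ln (exp 1 * real d / real s) / (300 * real n)"
  have k: "0 < k" "s = Suc k" and sn: "real s \<le> real n" and sd: "55 * s \<le> d"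
    using False assms(4) by (auto simp: k_def)
  have m: "55 \<le> m" using sd False by (simp add: m_def less_eq_div_iff_mult_less_eq)
  have p: "0 < p" "p \<le> 1" using k sn by (auto simp: p_def)
  have "k * m + m \<le> d" using k div_times_less_eq_dividend[of d s] by (simp add: m_def algebra_simps)
  then have km: "k * m < d" using m by linarith
  have "exp 1 \<le> real m" using exp_le m by linarith
  then have ln_m: "1 \<le> ln (real m)" using m by (simp add: ln_ge_iff)
  \<comment> \<open>Rounding in \<open>m\<close> costs at most a factor \<open>2 \<le> e\<close>:
    from \<open>d / s \<le> 2 m\<close> the logarithm of \<open>e d / s\<close> is at most
    \<open>2 + ln m \<le> 3 ln m\<close>.\<close>
  have "d < Suc m * s" using dividend_less_times_div[of s d] False by (simp add: m_def algebra_simps)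
  also have "\<dots> \<le> 2 * m * s" using m by (intro mult_right_mono) auto
  finally have "real d < real (2 * m * s)" by (simp only: of_nat_less_iff)
  then have "real d / real s \<le> 2 * real m" using k by (simp add: field_simps)
  then have "exp 1 * real d / real s \<le> exp 1 * (2 * real m)"
    using mult_left_mono[of "real d / real s" "2 * real m" "exp 1"] by simp
  also have "\<dots> \<le> exp 1 * (exp 1 * real m)"
    using exp_ge_add_one_self[of "1::real"] by (intro mult_left_mono mult_right_mono) auto
  finally have "ln (exp 1 * real d / real s) \<le> ln (exp 1 * (exp 1 * real m))"
    using k sd m by (subst ln_le_cancel_iff) auto
  also have "\<dots> \<le> 3 * ln (real m)" using m ln_m by (simp add: ln_mult)
  finally have "real s * ln (exp 1 * real d / real s) \<le> real s * (3 * ln (real m))"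
    by (rule mult_left_mono) simp
  then have "r \<le> real s / 10 * ln (real m)" by (simp add: r_def)
  then have r: "r / ln (real m) \<le> real s / 10" using ln_m by (simp add: pos_divide_le_eq)
  have np: "real n * p = real k / 10" using sn k by (simp add: p_def)
  \<comment> \<open>With \<open>e - 1 \<le> 2\<close> the total exponent is at most
    \<open>s / 10 - k + k / 5\<close>, which is below \<open>- s / 35\<close> because
    \<open>s = k + 1\<close> and \<open>k \<ge> 35\<close>.\<close>
  have "real n * p * (exp 1 - 1) \<le> real k / 10 * 2"
    unfolding np using exp_le by (intro mult_left_mono) auto
  moreover have sk: "real s = real k + 1" "real k \<ge> 35" using k False by auto
  ultimately have "r / ln (real m) - real k + real n * p * (exp 1 - 1) \<le> - (real s / 35)"
    using r by linarith
  then have small: "exp (r / ln (real m) - real k + real n * p * (exp 1 - 1)) \<le> 3 * exp (- (real s / 35))"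
    by (smt (verit) exp_le_cancel_iff exp_gt_zero)
  have e: "p / real k * r = ?e" using k by (simp add: p_def r_def)
  obtain P where P: "P \<in> sparse_dists (Suc k) d"
    and le: "measure_pmf.prob (iid_sample n P) {x. KL d P (\<Phi> x) < ereal ?e}
      \<le> exp (r / ln (real m) - real k + real n * p * (exp 1 - 1))"
    using exists_spiked_prob_KL_less[OF k(1) p km _ assms(5), of r] m unfolding e by auto
  have "measure_pmf.prob (iid_sample n P) {x. ereal ?e \<le> KL d P (\<Phi> x)}
      = 1 - measure_pmf.prob (iid_sample n P) {x. KL d P (\<Phi> x) < ereal ?e}"
    by (subst measure_pmf.prob_compl[symmetric]) (auto intro!: arg_cong2[where f = measure])
  then show ?thesis using P le small k(2) by (intro bexI[of _ P]) auto
qed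

end
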